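(* Let $\mathcal{A}$ be a finite alphabet and let $X\subset\mathcal{A}^{\mathbb{Z}}$ be a subshift. Suppose there exists $\varepsilon>0$ such that $P_X(n)=O(n^{2-\varepsilon})$ as $n\to\infty$. Then $\operatorname{Aut}(X)$ is amenable as a countable discrete group.
   Context: $\mathcal{A}^{\mathbb{Z}}$ carries the product topology (with $\mathcal{A}$ discrete), and $\sigma:\mathcal{A}^{\mathbb{Z}}\to\mathcal{A}^{\mathbb{Z}}$ is the left shift, $(\sigma x)_i=x_{i+1}$. A subshift is a closed, $\sigma$-invariant set $X\subset\mathcal{A}^{\mathbb{Z}}$ (with $\sigma X=X$), together with $\sigma|_X$. A word $w=(w_0,\dots,w_{n-1})\in\mathcal{A}^n$ belongs to $\mathcal{L}_n(X)$ if there is $x\in X$ with $x_i=w_i$ for $0\le i<n$. The complexity function is $P_X(n)=|\mathcal{L}_n(X)|$. $\operatorname{Aut}(X)$ is the group, under composition, of all homeomorphisms $\phi:X\to X$ with $\phi\circ\sigma=\sigma\circ\phi$; it is a countable group. *)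

theory Defs
  imports
    "HOL-Analysis.Function_Topology"
    "HOL-Library.Landau_Symbols"
    "HOL-Algebra.Bij"
    "HOL-Algebra.Coset"
begin

definition full_shift :: "'a set \<Rightarrow> (int \<Rightarrow> 'a) topology" where
  "full_shift A = product_topology (\<lambda>_. discrete_topology A) UNIV"

definition shift :: "(int \<Rightarrow> 'a) \<Rightarrow> (int \<Rightarrow> 'a)" where
  "shift x = (\<lambda>i. x (i + 1))"

definition subshift :: "'a set \<Rightarrow> (int \<Rightarrow> 'a) set \<Rightarrow> bool" where
  "subshift A X \<longleftrightarrow> closedin (full_shift A) X \<and> shift ` X = X"

definition language :: "(int \<Rightarrow> 'a) set \<Rightarrow> nat \<Rightarrow> 'a list set" where
  "language X n = {w. length w = n \<and> (\<exists>x\<in>X. \<forall>i<n. x (int i) = w ! i)}"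

definition complexity :: "(int \<Rightarrow> 'a) set \<Rightarrow> nat \<Rightarrow> nat" where
  "complexity X n = card (language X n)"

(* As in BijGroup, a self-map of X is represented by the function that is undefined
   outside X, so that distinct elements of the carrier are distinct maps on X. *)
definition aut_group ::
    "'a set \<Rightarrow> (int \<Rightarrow> 'a) set \<Rightarrow> ((int \<Rightarrow> 'a) \<Rightarrow> (int \<Rightarrow> 'a)) monoid" where
  "aut_group A X = (BijGroup X)
     \<lparr>carrier := {\<phi> \<in> Bij X.
        homeomorphic_map (subtopology (full_shift A) X) (subtopology (full_shift A) X) \<phi> \<and>
        (\<forall>x\<in>X. \<phi> (shift x) = shift (\<phi> x))}\<rparr>"

(* Amenability of a discrete group, in von Neumann's sense: there is a left-invariant
   finitely additive probability measure defined on all subsets of the group. *)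
definition amenable_group :: "('g, 'r) monoid_scheme \<Rightarrow> bool" where
  "amenable_group G \<longleftrightarrow> group G \<and>
     (\<exists>\<mu> :: 'g set \<Rightarrow> real.
        \<mu> (carrier G) = 1 \<and>
        (\<forall>S. S \<subseteq> carrier G \<longrightarrow> 0 \<le> \<mu> S) \<and>
        (\<forall>S T. S \<subseteq> carrier G \<longrightarrow> T \<subseteq> carrier G \<longrightarrow> S \<inter> T = {} \<longrightarrow>
           \<mu> (S \<union> T) = \<mu> S + \<mu> T) \<and>
        (\<forall>g S. g \<in> carrier G \<longrightarrow> S \<subseteq> carrier G \<longrightarrow> \<mu> (g <#\<^bsub>G\<^esub> S) = \<mu> S))"

end

theory Submission
  imports Defs "HOL-Library.Discrete_Functions" "HOL-Real_Asymp.Real_Asymp"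
begin

text \<open>Every finitely generated subgroup of the automorphism group has subexponential growth, which
  yields Folner sets. An element of word length \<open>k\<close> is a sliding block code reading words of some length
  \<open>n = O(k)\<close>. All words of length \<open>n\<close> occur in initial segments of polynomial length of few points of \<open>X\<close>:
  one point for each edge of the Rauzy graph that leaves a right special word, and one for each cycle
  without right special words. Edges of the first kind number at most \<open>2 (P(n+1) - P(n))\<close>, which is
  \<open>O(n^(1-\<epsilon>))\<close> for infinitely many \<open>n\<close>, and a dyadic count by length bounds the cycles by
  \<open>O(n^(1-\<epsilon>) log n)\<close>. The images of these points at polynomially many positions determine the
  element, so the ball of radius \<open>k\<close> has at most \<open>exp (O(n^(1-\<epsilon>) (log n)^2))\<close> elements.\<close>

section \<open>Amenability and subexponential growth\<close>

text \<open>Tychonoff's theorem. Finitely additive probability measures will be points of such a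
  cube, with the sets as coordinates.\<close>

lemma compact_unit_cube: "compact {f :: 'b \<Rightarrow> real. \<forall>S. f S \<in> {0..1}}"
proof -
  have "compactin (product_topology (\<lambda>_::'b. euclidean :: real topology) UNIV) (PiE UNIV (\<lambda>_. {0..1}))"
    by (simp add: compactin_PiE)
  then show ?thesis
    by (simp add: euclidean_product_topology PiE_def Pi_def)
qed

lemma (in group) l_coset_inter:
  assumes "g \<in> carrier G" "T \<subseteq> carrier G" "F \<subseteq> carrier G"
  shows "g <# (T \<inter> F) = (g <# T) \<inter> (g <# F)"
  using assms unfolding l_coset_def by (auto simp: subset_iff)

lemma (in group) card_l_coset:
  assumes "g \<in> carrier G" "F \<subseteq> carrier G"
  shows "card (g <# F) = card F"
proof -
  have "g <# F = (\<lambda>x. g \<otimes> x) ` F"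
    by (auto simp: l_coset_def)
  moreover have "inj_on (\<lambda>x. g \<otimes> x) F"
    using assms by (auto simp: inj_on_def subset_iff)
  ultimately show ?thesis
    by (simp add: card_image)
qed

lemma (in group) finite_l_coset: "finite F \<Longrightarrow> finite (g <# F)"
  by (auto simp: l_coset_def)

text \<open>Translation by \<open>g\<close> preserves the size of \<open>T \<inter> F\<close>.
  Replacing \<open>g <# F\<close> by \<open>F\<close> then changes the count by at most one of the
  two differences of these sets, which are equally large.\<close>

lemma (in group) card_l_coset_Int_diff_le:
  assumes g: "g \<in> carrier G" and F: "finite F" "F \<subseteq> carrier G" and T: "T \<subseteq> carrier G"
  shows "\<bar>real (card ((g <# T) \<inter> F)) - real (card (T \<inter> F))\<bar> \<le> card ((g <# F) - F)"
proof -
  let ?gF = "g <# F"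
  have fin: "finite ?gF"
    using F finite_l_coset by blast
  have "card F = card ?gF"
    using card_l_coset g F by simp
  then have sym: "card (F - ?gF) = card (?gF - F)"
    using card_Diff_subset_Int[of F ?gF] card_Diff_subset_Int[of ?gF F] fin F
    by (simp add: Int_commute)
  have eq: "card (T \<inter> F) = card ((g <# T) \<inter> ?gF)"
    using card_l_coset[of g "T \<inter> F"] l_coset_inter[of g T F] g F T by (simp add: le_infI1)
  have "card ((g <# T) \<inter> ?gF) \<le> card (((g <# T) \<inter> F) \<union> (?gF - F))"
    by (rule card_mono) (use F fin in auto)
  then have 1: "card ((g <# T) \<inter> ?gF) \<le> card ((g <# T) \<inter> F) + card (?gF - F)"
    using card_Un_le order_trans by blast
  have "card ((g <# T) \<inter> F) \<le> card (((g <# T) \<inter> ?gF) \<union> (F - ?gF))"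
    by (rule card_mono) (use F fin in auto)
  then have 2: "card ((g <# T) \<inter> F) \<le> card ((g <# T) \<inter> ?gF) + card (F - ?gF)"
    using card_Un_le order_trans by blast
  show ?thesis
    using 1 2 sym eq by linarith
qed

text \<open>Normalised counting measures on Folner sets are almost invariant. Compactness turns them
  into an invariant mean: a common point of \<open>K\<close> and all the closed sets
  \<open>C (g, \<delta>)\<close>.\<close>

lemma amenable_group_if_Folner:
  fixes G (structure)
  assumes "group G"
    and Folner: "\<And>S (\<delta>::real). \<lbrakk>finite S; S \<subseteq> carrier G; \<delta> > 0\<rbrakk> \<Longrightarrow>
      \<exists>F. finite F \<and> F \<noteq> {} \<and> F \<subseteq> carrier G \<and> (\<forall>g\<in>S. card ((g <# F) - F) \<le> \<delta> * card F)"
  shows "amenable_group G"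
proof -
  interpret group G by fact
  define K where "K = {\<mu> :: 'a set \<Rightarrow> real. \<forall>S. \<mu> S \<in> {0..1}} \<inter>
     {\<mu>. \<mu> (carrier G) = 1 \<and> (\<forall>S T. S \<inter> T = {} \<longrightarrow> \<mu> (S \<union> T) = \<mu> S + \<mu> T)}"
  define C where "C = (\<lambda>(g, \<delta>). {\<mu> :: 'a set \<Rightarrow> real.
     \<forall>T. T \<subseteq> carrier G \<longrightarrow> \<bar>\<mu> (g <# T) - \<mu> T\<bar> \<le> \<delta>})"
  have "closed {\<mu> :: 'a set \<Rightarrow> real. \<mu> (carrier G) = 1 \<and>
      (\<forall>S T. S \<inter> T = {} \<longrightarrow> \<mu> (S \<union> T) = \<mu> S + \<mu> T)}"
    by (intro closed_Collect_conj closed_Collect_all closed_Collect_imp closed_Collect_eq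
        continuous_intros continuous_on_product_coordinates) auto
  then have "compact K"
    unfolding K_def by (intro compact_Int_closed compact_unit_cube)
  have closed: "closed (C i)" for i
    unfolding C_def split_def
    by (intro closed_Collect_all closed_Collect_imp closed_Collect_le
        continuous_intros continuous_on_product_coordinates) auto
  have "K \<inter> (\<Inter>i\<in>carrier G \<times> {0<..}. C i) \<noteq> {}"
  proof (rule compact_imp_fip_image[OF \<open>compact K\<close> closed])
    fix I' assume I': "finite I'" "I' \<subseteq> carrier G \<times> {0::real<..}"
    \<comment> \<open>One Folner set for the smallest tolerance meets all conditions in
      \<open>I'\<close>; the \<open>1\<close> serves the case of empty \<open>I'\<close>.\<close>
    define \<delta> where "\<delta> = Min (insert 1 (snd ` I'))"
    have \<delta>: "\<delta> > 0" "\<And>i. i \<in> I' \<Longrightarrow> \<delta> \<le> snd i"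
      using I' by (auto simp: \<delta>_def)
    have sub: "fst ` I' \<subseteq> carrier G"
      using I' by auto
    obtain F where F: "finite F" "F \<noteq> {}" "F \<subseteq> carrier G"
      and FF: "\<And>g. g \<in> fst ` I' \<Longrightarrow> real (card ((g <# F) - F)) \<le> \<delta> * real (card F)"
      using Folner[OF finite_imageI[OF I'(1)] sub \<delta>(1)] by blast
    define \<mu> where "\<mu> T = real (card (T \<inter> F)) / card F" for T
    have pos: "card F > 0"
      using F by (simp add: card_gt_0_iff)
    have "\<mu> S \<in> {0..1}" for S
      using F pos by (auto simp: \<mu>_def divide_le_eq card_mono)
    moreover have "\<mu> (carrier G) = 1"
      using F pos by (simp add: \<mu>_def Int_absorb1)
    moreover have "\<mu> (S \<union> T) = \<mu> S + \<mu> T" if "S \<inter> T = {}" for S T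
    proof -
      have "card ((S \<union> T) \<inter> F) = card (S \<inter> F) + card (T \<inter> F)"
        unfolding Int_Un_distrib2 by (rule card_Un_disjoint) (use F that in auto)
      then show ?thesis
        by (simp add: \<mu>_def add_divide_distrib)
    qed
    ultimately have "\<mu> \<in> K"
      by (auto simp: K_def)
    moreover have "\<mu> \<in> C i" if "i \<in> I'" for i
    proof -
      have "\<bar>\<mu> (fst i <# T) - \<mu> T\<bar> \<le> snd i" if T: "T \<subseteq> carrier G" for T
      proof -
        have "\<bar>\<mu> (fst i <# T) - \<mu> T\<bar> =
            \<bar>real (card ((fst i <# T) \<inter> F)) - real (card (T \<inter> F))\<bar> / card F"
          by (simp add: \<mu>_def flip: diff_divide_distrib)
        also have "\<dots> \<le> real (card ((fst i <# F) - F)) / card F"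
          using card_l_coset_Int_diff_le[of "fst i" F T] that \<open>i \<in> I'\<close> I' F
          by (intro divide_right_mono) auto
        also have "\<dots> \<le> \<delta>"
          using FF[of "fst i"] \<open>i \<in> I'\<close> pos by (simp add: divide_le_eq)
        finally show ?thesis
          using \<delta>(2)[OF \<open>i \<in> I'\<close>] by simp
      qed
      then show ?thesis
        by (simp add: C_def split_def)
    qed
    ultimately show "K \<inter> (\<Inter>i\<in>I'. C i) \<noteq> {}"
      by blast
  qed
  then obtain \<mu> where \<mu>: "\<mu> \<in> K" "\<And>g \<delta>. \<lbrakk>g \<in> carrier G; \<delta> > 0\<rbrakk> \<Longrightarrow> \<mu> \<in> C (g, \<delta>)"
    by auto
  have "\<mu> (g <# T) = \<mu> T" if "g \<in> carrier G" "T \<subseteq> carrier G" for g T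
  proof -
    have "\<bar>\<mu> (g <# T) - \<mu> T\<bar> \<le> 0 + \<delta>" if "\<delta> > 0" for \<delta>
      using \<mu>(2)[OF \<open>g \<in> carrier G\<close> that] \<open>T \<subseteq> carrier G\<close> by (auto simp: C_def)
    then have "\<bar>\<mu> (g <# T) - \<mu> T\<bar> \<le> 0"
      by (rule field_le_epsilon)
    then show ?thesis by simp
  qed
  with \<mu>(1) show ?thesis
    unfolding amenable_group_def using \<open>group G\<close>
    by (auto simp: K_def intro!: exI[of _ \<mu>])
qed

section \<open>Word balls and their growth\<close>

fun word_ball :: "('g, 'r) monoid_scheme \<Rightarrow> 'g set \<Rightarrow> nat \<Rightarrow> 'g set" where
  "word_ball G S 0 = {\<one>\<^bsub>G\<^esub>}"
| "word_ball G S (Suc k) = word_ball G S k \<union> (\<Union>s\<in>S. s <#\<^bsub>G\<^esub> word_ball G S k)"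

lemma (in group) word_ball:
  assumes "finite S" "S \<subseteq> carrier G"
  shows finite_word_ball: "finite (word_ball G S k)"
    and word_ball_subset: "word_ball G S k \<subseteq> carrier G"
proof -
  show "finite (word_ball G S k)"
    by (induction k) (use assms finite_l_coset in auto)
  show "word_ball G S k \<subseteq> carrier G"
  proof (induction k)
    case (Suc k)
    then show ?case
      using assms l_coset_subset_G[OF Suc] by (auto simp: subset_iff)
  qed simp
qed

lemma one_in_word_ball: "\<one>\<^bsub>G\<^esub> \<in> word_ball G S k"
  by (induction k) auto

text \<open>If each ball exceeded the previous one by a factor above \<open>1 + \<delta>\<close>,
  growth would be exponential. So some ball is nearly as large as the next one, which contains its
  translates by \<open>S\<close>; that ball is a Folner set.\<close>

lemma amenable_group_if_subexponential_growth:
  fixes G (structure)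
  assumes "group G"
    and growth: "\<And>S (\<beta>::real). \<lbrakk>finite S; S \<subseteq> carrier G; \<beta> > 1\<rbrakk> \<Longrightarrow>
      \<exists>k. card (word_ball G S k) < \<beta> ^ k"
  shows "amenable_group G"
proof (rule amenable_group_if_Folner[OF \<open>group G\<close>])
  interpret group G by fact
  fix S and \<delta> :: real assume S: "finite S" "S \<subseteq> carrier G" and \<delta>: "\<delta> > 0"
  let ?B = "word_ball G S"
  have "\<exists>k. card (?B (Suc k)) \<le> (1 + \<delta>) * card (?B k)"
  proof (rule ccontr)
    assume "\<not> ?thesis"
    then have *: "(1 + \<delta>) * card (?B k) < card (?B (Suc k))" for k
      by (auto simp: not_le)
    have "(1 + \<delta>) ^ k \<le> card (?B k)" for k
    proof (induction k)
      case (Suc k)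
      have "(1 + \<delta>) ^ Suc k \<le> (1 + \<delta>) * card (?B k)"
        using Suc \<delta> by (auto intro: mult_left_mono)
      with *[of k] show ?case by linarith
    qed simp
    moreover obtain k where "real (card (?B k)) < (1 + \<delta>) ^ k"
      using growth[OF S, of "1 + \<delta>"] \<delta> by auto
    ultimately show False
      by (meson not_le)
  qed
  then obtain k where k: "real (card (?B (Suc k))) \<le> (1 + \<delta>) * real (card (?B k))" ..
  have fin: "finite (?B k)" for k
    using finite_word_ball[OF S] .
  have "card ((g <# ?B k) - ?B k) \<le> \<delta> * card (?B k)" if "g \<in> S" for g
  proof -
    have "card ((g <# ?B k) - ?B k) \<le> card (?B (Suc k) - ?B k)"
      using that fin by (intro card_mono finite_Diff fin) auto
    also have "real \<dots> = card (?B (Suc k)) - real (card (?B k))"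
      using fin card_mono[OF fin, of "?B k" "Suc k"]
      by (subst card_Diff_subset) (auto simp: of_nat_diff)
    finally show ?thesis
      using k by (simp add: algebra_simps)
  qed
  then show "\<exists>F. finite F \<and> F \<noteq> {} \<and> F \<subseteq> carrier G \<and>
      (\<forall>g\<in>S. card ((g <# F) - F) \<le> \<delta> * card F)"
    using fin word_ball_subset[OF S] one_in_word_ball[of G S k] by (intro exI[of _ "?B k"]) auto
qed

section \<open>Covering the words of a shift space by few points\<close>

definition window :: "(int \<Rightarrow> 'a) \<Rightarrow> int \<Rightarrow> nat \<Rightarrow> 'a list" where
  "window x i n = map (\<lambda>j. x (i + int j)) [0..<n]"

definition translate :: "int \<Rightarrow> (int \<Rightarrow> 'a) \<Rightarrow> (int \<Rightarrow> 'a)" where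
  "translate c x = (\<lambda>i. x (i + c))"

lemma length_window [simp]: "length (window x i n) = n"
  by (simp add: window_def)

lemma nth_window [simp]: "j < n \<Longrightarrow> window x i n ! j = x (i + int j)"
  by (simp add: window_def)

lemma window_eq_iff: "window x i n = window y k n \<longleftrightarrow> (\<forall>j<n. x (i + int j) = y (k + int j))"
  by (auto simp: list_eq_iff_nth_eq)

lemma window_translate [simp]: "window (translate c x) i n = window x (i + c) n"
  by (simp add: window_eq_iff translate_def algebra_simps)

lemma take_window: "take m (window x i n) = window x i (min m n)"
  by (rule nth_equalityI) auto

lemma window_step:
  assumes "window x i n = window y k n" "x (i + int n) = y (k + int n)"
  shows "window x (i + 1) n = window y (k + 1) n"
  unfolding window_eq_iff
proof (intro allI impI)
  fix j assume "j < n"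
  then consider "Suc j < n" | "Suc j = n" by linarith
  then show "x (i + 1 + int j) = y (k + 1 + int j)"
  proof cases
    case 1
    then show ?thesis
      using assms(1)[unfolded window_eq_iff, rule_format, of "Suc j"] by (simp add: algebra_simps)
  next
    case 2
    then show ?thesis
      using assms(2) by (auto simp: algebra_simps)
  qed
qed

lemma translate_shift: "translate 1 = shift"
  by (simp add: translate_def shift_def fun_eq_iff)

lemma translate_translate [simp]: "translate c (translate d x) = translate (c + d) x"
  by (simp add: translate_def algebra_simps)

lemma translate_0 [simp]: "translate 0 x = x"
  by (simp add: translate_def)

text \<open>Position \<open>d + p + q\<close> of \<open>u\<close> descends by the period of
  \<open>u\<close> to \<open>d + q\<close>, crosses to \<open>v\<close>, descends to
  \<open>d\<close>, crosses back, climbs to \<open>d + p\<close>, crosses again and climbs to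
  \<open>d + p + q\<close> in \<open>v\<close>. Every crossing is at a smaller position, where the
  induction hypothesis applies.\<close>

lemma weak_Fine_Wilf:
  assumes len: "length u = n" "length v = n" and pq: "p \<ge> 1" "q \<ge> 1"
    and u: "\<And>i. i + p < n \<Longrightarrow> u ! (i + p) = u ! i"
    and v: "\<And>i. i + q < n \<Longrightarrow> v ! (i + q) = v ! i"
    and eq: "\<And>i. \<lbrakk>i < n; i < p + q\<rbrakk> \<Longrightarrow> u ! i = v ! i"
  shows "u = v"
proof (rule nth_equalityI)
  fix i assume "i < length u"
  then show "u ! i = v ! i"
  proof (induction i rule: less_induct)
    case (less i)
    show ?case
    proof (cases "i < p + q")
      case False
      then obtain d where d: "i = d + p + q"
        by (metis add.commute add.assoc le_Suc_ex not_le)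
      have "u ! i = u ! (d + q)"
        using u[of "d + q"] d less.prems len by (simp add: algebra_simps)
      also have "\<dots> = v ! (d + q)"
        using less.IH[of "d + q"] d less.prems len pq by simp
      also have "\<dots> = v ! d"
        using v[of d] d less.prems len by simp
      also have "\<dots> = u ! d"
        using less.IH[of d] d less.prems len pq by simp
      also have "\<dots> = u ! (d + p)"
        using u[of d] d less.prems len by simp
      also have "\<dots> = v ! (d + p)"
        using less.IH[of "d + p"] d less.prems len pq by simp
      also have "\<dots> = v ! i"
        using v[of "d + p"] d less.prems len by simp
      finally show ?thesis .
    qed (use eq less.prems len in auto)
  qed
qed (use len in simp)

section \<open>Words of a shift space and its Rauzy graphs\<close>

locale shift_space =
  fixes A :: "'a set" and X :: "(int \<Rightarrow> 'a) set"
  assumes finite_alphabet: "finite A"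
    and in_alphabet: "x \<in> X \<Longrightarrow> x i \<in> A"
    and shift_image: "shift ` X = X"
begin

lemma translate_in: "x \<in> X \<Longrightarrow> translate c x \<in> X"
proof (induction c rule: int_induct[of _ 0])
  case (step1 i)
  then have "shift (translate i x) \<in> X"
    using shift_image by blast
  then show ?case
    by (simp add: add.commute flip: translate_shift)
next
  case (step2 i)
  \<comment> \<open>Going back one step uses that the shift maps \<open>X\<close> onto
    \<open>X\<close>.\<close>
  then obtain y where y: "y \<in> X" "translate i x = shift y"
    using shift_image by blast
  have "translate (i - 1) x = translate (- 1) (translate i x)"
    by simp
  also have "\<dots> = translate (- 1) (translate 1 y)"
    using y by (simp only: translate_shift)
  finally show ?case
    using y by simp
qed simp

lemma language_eq: "language X n = (\<lambda>x. window x 0 n) ` X"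
proof (intro equalityI subsetI)
  fix w assume "w \<in> language X n"
  then obtain x where "x \<in> X" "length w = n" "\<forall>i<n. x (int i) = w ! i"
    by (auto simp: language_def)
  then have "w = window x 0 n"
    by (intro nth_equalityI) auto
  then show "w \<in> (\<lambda>x. window x 0 n) ` X"
    using \<open>x \<in> X\<close> by blast
qed (auto simp: language_def)

lemma window_in_language: "x \<in> X \<Longrightarrow> window x i n \<in> language X n"
  using translate_in[of x i] by (auto simp: language_eq intro!: image_eqI[of _ _ "translate i x"])

lemma finite_language: "finite (language X n)"
proof (rule finite_subset)
  show "language X n \<subseteq> {w. set w \<subseteq> A \<and> length w = n}"
    using in_alphabet by (auto simp: language_eq window_def)
  show "finite {w. set w \<subseteq> A \<and> length w = n}"
    using finite_alphabet by (rule finite_lists_length_eq)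
qed

lemma take_language: "m \<le> n \<Longrightarrow> take m ` language X n = language X m"
  by (simp add: language_eq image_image take_window min_absorb1)

lemma complexity_mono: "m \<le> n \<Longrightarrow> complexity X m \<le> complexity X n"
  unfolding complexity_def using card_image_le[OF finite_language] take_language by metis

text \<open>In terms of the Rauzy graph of order \<open>n\<close> (vertices: words of length \<open>n\<close>, edges: words of length
  \<open>n + 1\<close>), a word is deterministic if it is not right special, the branches are the edges leaving
  right special words, and the cyclic words are those on a cycle without right special words.\<close>

definition deterministic :: "nat \<Rightarrow> 'a list \<Rightarrow> bool" where
  "deterministic n w \<longleftrightarrow> (\<forall>x\<in>X. \<forall>y\<in>X. \<forall>i k. window x i n = w \<longrightarrow> window y k n = w \<longrightarrow>
     x (i + int n) = y (k + int n))"

text \<open>Each deterministic window fixes the next letter, hence the next window. Equalities of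
  windows are propagated to the right in this way.\<close>

lemma deterministic_run:
  assumes "x \<in> X" "y \<in> X" "window x i n = window y k n"
    and "\<And>t. t < m \<Longrightarrow> deterministic n (window x (i + int t) n)"
  shows "window x (i + int m) n = window y (k + int m) n"
  using assms(4)
proof (induction m)
  case (Suc m)
  then have eq: "window x (i + int m) n = window y (k + int m) n"
    by simp
  have "x (i + int m + int n) = y (k + int m + int n)"
    using Suc.prems[of m] eq assms(1,2) unfolding deterministic_def by auto
  from window_step[OF eq this] show ?case
    by (simp add: algebra_simps)
qed (use assms(3) in simp)

definition branches :: "nat \<Rightarrow> 'a list set" where
  "branches n = {e \<in> language X (Suc n). \<not> deterministic n (take n e)}"

text \<open>A right special word with \<open>f \<ge> 2\<close> extensions gives
  \<open>f \<le> 2 * (f - 1)\<close> branches; a deterministic word gives none and has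
  \<open>f \<ge> 1\<close>. The sum of \<open>f - 1\<close> over all words is the increment of the
  complexity. The additive form avoids subtraction of naturals.\<close>

lemma card_branches_le: "card (branches n) + 2 * complexity X n \<le> 2 * complexity X (Suc n)"
proof -
  define fib where "fib w = {e. e \<in> language X (Suc n) \<and> take n e = w}" for w
  define bfib where "bfib w = {e. e \<in> branches n \<and> take n e = w}" for w
  have finb: "finite (branches n)"
    using finite_language[of "Suc n"] by (auto simp: branches_def)
  have finf: "finite (fib w)" for w
    using finite_language[of "Suc n"] by (auto simp: fib_def)
  have sub: "take n ` language X (Suc n) \<subseteq> language X n"
    using take_language[of n "Suc n"] by simp
  have 1: "(\<Sum>w\<in>language X n. card (fib w)) = complexity X (Suc n)"
    using sum.group[OF finite_language finite_language sub, of "\<lambda>_. 1::nat"]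
    by (simp add: complexity_def fib_def)
  have subb: "take n ` branches n \<subseteq> language X n"
    using sub by (auto simp: branches_def)
  have 2: "(\<Sum>w\<in>language X n. card (bfib w)) = card (branches n)"
    using sum.group[OF finb finite_language subb, of "\<lambda>_. 1::nat"] by (simp add: bfib_def)
  have 3: "card (bfib w) + 2 \<le> 2 * card (fib w)" if w: "w \<in> language X n" for w
  proof (cases "deterministic n w")
    case True
    then have "bfib w = {}"
      by (auto simp: bfib_def branches_def)
    moreover have "w \<in> take n ` language X (Suc n)"
      using w take_language[of n "Suc n"] by simp
    then have "fib w \<noteq> {}"
      by (auto simp: fib_def)
    then have "card (fib w) \<ge> 1"
      using finf by (simp add: Suc_leI card_gt_0_iff)
    ultimately show ?thesis
      by simp
  next
    case False
    then have "bfib w = fib w"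
      by (auto simp: bfib_def fib_def branches_def)
    obtain x y i k where xy: "x \<in> X" "y \<in> X" "window x i n = w" "window y k n = w"
      "x (i + int n) \<noteq> y (k + int n)"
      using False unfolding deterministic_def by blast
    have ne: "window x i (Suc n) \<noteq> window y k (Suc n)"
      unfolding window_eq_iff using xy(5) by blast
    have "{window x i (Suc n), window y k (Suc n)} \<subseteq> fib w"
      using xy by (auto simp: fib_def window_in_language take_window min_absorb1)
    then have "card {window x i (Suc n), window y k (Suc n)} \<le> card (fib w)"
      using card_mono[OF finf] by blast
    then show ?thesis
      using ne \<open>bfib w = fib w\<close> by simp
  qed
  have "(\<Sum>w\<in>language X n. card (bfib w) + 2) \<le> (\<Sum>w\<in>language X n. 2 * card (fib w))"
    using 3 by (rule sum_mono)
  then have "(\<Sum>w\<in>language X n. card (bfib w)) + 2 * complexity X n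
      \<le> 2 * (\<Sum>w\<in>language X n. card (fib w))"
    by (simp only: sum.distrib sum_distrib_left complexity_def) simp
  then show ?thesis
    by (simp only: 1 2)
qed

section \<open>Cycles without right special words\<close>

definition cyclic :: "nat \<Rightarrow> 'a list set" where
  "cyclic n = {w. \<exists>x\<in>X. \<exists>p::nat. p \<ge> 1 \<and> window x 0 n = w \<and> window x (int p) n = w \<and>
     (\<forall>t::nat. deterministic n (window x (int t) n))}"

definition cycle :: "nat \<Rightarrow> 'a list \<Rightarrow> 'a list set" where
  "cycle n w = {u. \<exists>x\<in>X. \<exists>t::nat. window x 0 n = w \<and> window x (int t) n = u}"

lemma cyclic_subset_language: "cyclic n \<subseteq> language X n"
  by (auto simp: cyclic_def window_in_language)

lemma cycle_subset_language: "cycle n w \<subseteq> language X n"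
  by (auto simp: cycle_def window_in_language)

lemma finite_cycle: "finite (cycle n w)"
  using finite_subset[OF cycle_subset_language finite_language] .

lemma card_cycle_le: "card (cycle n w) \<le> complexity X n"
  unfolding complexity_def using finite_language cycle_subset_language by (rule card_mono)

text \<open>Follow a point that shows \<open>w\<close> to the left. The nearest right special word
  within \<open>complexity X n\<close> steps, if any, is left by a branch after which
  \<open>w\<close> is forced. Otherwise some window repeats, and the absence of choices turns the
  repetition into a cycle through \<open>w\<close>.\<close>

lemma cyclic_or_after_branch:
  assumes "w \<in> language X n"
  shows "w \<in> cyclic n \<or> (\<exists>e\<in>branches n. \<exists>j\<le>complexity X n. \<forall>y\<in>X. \<forall>k.
    window y k (Suc n) = e \<longrightarrow> window y (k + int j) n = w)"
proof -
  let ?N = "complexity X n"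
  obtain x where x: "x \<in> X" "window x 0 n = w"
    using assms by (auto simp: language_eq)
  \<comment> \<open>\<open>j \<ge> 1\<close> because only the windows before \<open>w\<close> decide
    whether \<open>w\<close> is forced.\<close>
  define nd where "nd j \<longleftrightarrow> j \<ge> 1 \<and> \<not> deterministic n (window x (- int j) n)" for j
  show ?thesis
  proof (cases "\<exists>j\<le>?N. nd j")
    case True
    define j where "j = (LEAST j. nd j)"
    have j: "nd j" "j \<le> ?N" "\<And>i. i < j \<Longrightarrow> \<not> nd i"
      unfolding j_def using True by (blast intro: LeastI Least_le order_trans dest: not_less_Least)+
    have "j \<ge> 1"
      using j(1) by (simp add: nd_def)
    define e where "e = window x (- int j) (Suc n)"
    have "e \<in> branches n"
      using j(1) x by (simp add: e_def branches_def nd_def window_in_language take_window min_absorb1)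
    moreover have "window y (k + int j) n = w" if y: "y \<in> X" "window y k (Suc n) = e" for y k
    proof -
      \<comment> \<open>The last letter of \<open>e\<close> fixes the exit from the right special
        word; minimality of \<open>j\<close> makes the remaining windows before \<open>w\<close>
        deterministic.\<close>
      have "window x (- int j + 1) n = window y (k + 1) n"
      proof (rule window_step)
        have "take n (window x (- int j) (Suc n)) = take n (window y k (Suc n))"
          using y by (simp add: e_def)
        then show "window x (- int j) n = window y k n"
          by (simp add: take_window min_absorb1)
        show "x (- int j + int n) = y (k + int n)"
          using y(2) unfolding e_def window_eq_iff by auto
      qed
      then have "window x (- int j + 1 + int (j - 1)) n = window y (k + 1 + int (j - 1)) n"
      proof (rule deterministic_run[OF x(1) y(1)])
        fix t assume t: "t < j - 1"
        have "\<not> nd (j - 1 - t)" "1 \<le> j - 1 - t"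
          using t j(3)[of "j - 1 - t"] by auto
        then have "deterministic n (window x (- int (j - 1 - t)) n)"
          unfolding nd_def by blast
        moreover have "- int (j - 1 - t) = - int j + 1 + int t"
          using t by (simp add: of_nat_diff)
        ultimately show "deterministic n (window x (- int j + 1 + int t) n)"
          by (simp only:)
      qed
      then show ?thesis
        using \<open>j \<ge> 1\<close> x(2) by (simp add: of_nat_diff)
    qed
    ultimately show ?thesis
      using j(2) by blast
  next
    case False
    let ?f = "\<lambda>j. window x (- int j) n"
    \<comment> \<open>Pigeonhole: there are \<open>?N + 1\<close> positions but at most
      \<open>?N\<close> windows.\<close>
    have "?f ` {0..?N} \<subseteq> language X n"
      using x window_in_language by blast
    then have "card (?f ` {0..?N}) \<le> ?N"
      unfolding complexity_def by (intro card_mono finite_language) auto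
    then have "\<not> inj_on ?f {0..?N}"
      by (intro pigeonhole) simp
    then obtain a b where ab: "a < b" "b \<le> ?N" "?f a = ?f b"
      unfolding inj_on_def by (metis atLeastAtMost_iff linorder_neqE_nat)
    define p where "p = b - a"
    have p: "p \<ge> 1" "b = a + p"
      using ab by (auto simp: p_def)
    have det: "deterministic n (window x (- int j) n)" if "1 \<le> j" "j \<le> b" for j
      using False that ab by (auto simp: nd_def)
    \<comment> \<open>Running \<open>a\<close> steps from the equal windows at \<open>- b\<close>
      and \<open>- a\<close> reaches \<open>- p\<close> and \<open>0\<close>, so \<open>w\<close>
      also occurs at \<open>- p\<close>.\<close>
    have "window x (- int b + int a) n = window x (- int a + int a) n"
    proof (rule deterministic_run[OF x(1) x(1)])
      fix t assume "t < a"
      then show "deterministic n (window x (- int b + int t) n)"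
        using det[of "b - t"] ab by (simp add: of_nat_diff)
    qed (use ab in simp)
    then have start: "window x (- int p) n = w"
      using x(2) p(2) by simp
    \<comment> \<open>Before position \<open>0\<close> determinism is known; from there on the
      windows repeat with period \<open>p\<close>.\<close>
    have "deterministic n (window x (- int p + int t) n)" for t
    proof (induction t rule: less_induct)
      case (less t)
      show ?case
      proof (cases "t < p")
        case True
        then show ?thesis
          using det[of "p - t"] p by (simp add: of_nat_diff)
      next
        case False
        have "window x (- int p + int (t - p)) n = window x (0 + int (t - p)) n"
          by (rule deterministic_run[OF x(1) x(1)]) (use start x less p False in auto)
        then have "window x (- int p + int t) n = window x (- int p + int (t - p)) n"
          using False by (simp add: of_nat_diff)
        then show ?thesis
          using less.IH[of "t - p"] False p by simp
      qed
    qed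
    then have "w \<in> cyclic n"
      unfolding cyclic_def using x start p
      by (auto intro!: bexI[of _ "translate (- int p) x"] exI[of _ p] translate_in
          simp: add.commute)
    then show ?thesis ..
  qed
qed

text \<open>The walk is forced, so one point traces the whole cycle. The return time in
  \<open>cyclic\<close> is arbitrary; pigeonhole on the cycle replaces it by a period of at most the
  cycle's size.\<close>

lemma cyclicE:
  assumes "w \<in> cyclic n"
  obtains x p where "x \<in> X" "window x 0 n = w" "1 \<le> p" "p \<le> card (cycle n w)"
    "\<And>t::nat. deterministic n (window x (int t) n)"
    "\<And>t::nat. window x (int (t + p)) n = window x (int t) n"
    "cycle n w = range (\<lambda>t::nat. window x (int t) n)"
proof -
  obtain x r where x: "x \<in> X" "r \<ge> 1" "window x 0 n = w" "window x (int r) n = w"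
    and det: "\<And>t::nat. deterministic n (window x (int t) n)"
    using assms unfolding cyclic_def by blast
  have cyc: "cycle n w = range (\<lambda>t::nat. window x (int t) n)"
  proof (intro equalityI subsetI)
    fix u assume "u \<in> cycle n w"
    then obtain y t where y: "y \<in> X" "window y 0 n = w" "window y (int t) n = u"
      by (auto simp: cycle_def)
    have "window x (0 + int t) n = window y (0 + int t) n"
      by (rule deterministic_run) (use x y det in auto)
    then show "u \<in> range (\<lambda>t::nat. window x (int t) n)"
      using y by auto
  qed (use x in \<open>auto simp: cycle_def\<close>)
  have run: "window x (int (s + m)) n = window x (int (t + m)) n"
    if "window x (int s) n = window x (int t) n" for s t m
    using deterministic_run[of x x "int s" n "int t" m] that x det[of "s + _"] by simp
  let ?f = "\<lambda>t::nat. window x (int t) n"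
  let ?c = "card (cycle n w)"
  have "card (?f ` {0..?c}) \<le> ?c"
    using cyc by (intro card_mono finite_cycle) auto
  then have "\<not> inj_on ?f {0..?c}"
    by (intro pigeonhole) simp
  then obtain a b where ab: "a < b" "b \<le> ?c" "?f a = ?f b"
    unfolding inj_on_def by (metis atLeastAtMost_iff linorder_neqE_nat)
  have ret: "?f (m * r) = w" for m
  proof (induction m)
    case (Suc m)
    then show ?case
      using run[of 0 "m * r" r] x by (simp add: algebra_simps)
  qed (use x in simp)
  \<comment> \<open>Position \<open>a * r\<close> shows \<open>w\<close> and is not before
    \<open>a\<close>, so the repetition found at \<open>a\<close> carries over to
    \<open>w\<close>.\<close>
  have "a \<le> a * r"
    using x(2) by simp
  then have *: "?f (a * r + (b - a)) = ?f (a * r)"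
    using run[of a b "a * r - a"] ab by (simp add: algebra_simps)
  have "?f (t + (b - a)) = ?f t" for t
  proof -
    have "?f (b - a) = ?f (a * r + (b - a))"
      using run[of 0 "a * r" "b - a"] ret x by simp
    also have "\<dots> = ?f 0"
      using * ret x by simp
    finally show ?thesis
      using run[of "b - a" 0 t] by (simp add: algebra_simps)
  qed
  then show ?thesis
    using that[of x "b - a"] x det cyc ab by auto
qed

text \<open>Going round the cycle leads from \<open>u\<close> back to \<open>w\<close>. Hence
  distinct cycles are disjoint, which makes them countable by their words.\<close>

lemma cycle_eq:
  assumes "w \<in> cyclic n" "u \<in> cycle n w"
  shows "u \<in> cyclic n" "cycle n u = cycle n w"
proof -
  obtain x p where x: "x \<in> X" "window x 0 n = w" "1 \<le> p"
    and det: "\<And>t::nat. deterministic n (window x (int t) n)"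
    and per: "\<And>t::nat. window x (int (t + p)) n = window x (int t) n"
    and cyc: "cycle n w = range (\<lambda>t::nat. window x (int t) n)"
    using cyclicE[OF assms(1)] by metis
  obtain t where t: "u = window x (int t) n"
    using assms(2) cyc by auto
  let ?y = "translate (int t) x"
  have det': "deterministic n (window ?y (int s) n)" for s
    using det[of "s + t"] by simp
  show u: "u \<in> cyclic n"
    unfolding cyclic_def using translate_in[OF x(1), of "int t"] x(3) per[of t] det' t
    by (auto intro!: bexI[of _ ?y] exI[of _ p] simp: add.commute)
  have "cycle n u \<subseteq> cycle n w"
  proof
    fix v assume "v \<in> cycle n u"
    then obtain y s where y: "y \<in> X" "window y 0 n = u" "window y (int s) n = v"
      by (auto simp: cycle_def)
    have "window x (int t + int s) n = window y (0 + int s) n"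
      by (rule deterministic_run) (use x y t det[of "t + _"] in auto)
    then have "v = window x (int (t + s)) n"
      using y by simp
    then show "v \<in> cycle n w"
      using cyc by blast
  qed
  moreover have "cycle n w \<subseteq> cycle n u"
  proof
    fix v assume "v \<in> cycle n w"
    then obtain s where s: "v = window x (int s) n"
      using cyc by auto
    have "window x (int (s + m * p)) n = window x (int s) n" for m
    proof (induction m)
      case (Suc m)
      then show ?case
        using per[of "s + m * p"] by (simp add: algebra_simps)
    qed simp
    from this[of t] have v: "v = window x (int (s + t * p)) n"
      using s by simp
    \<comment> \<open>Adding \<open>t\<close> periods moves position \<open>s\<close> to one not
      before \<open>t\<close>, where \<open>?y\<close> starts.\<close>
    have "t \<le> t * p"
      using x(3) by simp
    then have "int (s + t * p - t) + int t = int (s + t * p)"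
      by linarith
    then have "v = window ?y (int (s + t * p - t)) n"
      using v by (simp only: window_translate)
    moreover have "window ?y 0 n = u"
      using t by simp
    ultimately show "v \<in> cycle n u"
      unfolding cycle_def using translate_in[OF x(1)] by blast
  qed
  ultimately show "cycle n u = cycle n w"
    by blast
qed

lemma self_in_cycle: "w \<in> cyclic n \<Longrightarrow> w \<in> cycle n w"
  by (auto simp: cyclic_def cycle_def intro!: exI[of _ "0::nat"])

text \<open>When the window returns after \<open>p\<close> steps, it overlaps itself, so
  \<open>p\<close> is a period of the word.\<close>

lemma cyclic_period:
  assumes "w \<in> cyclic n"
  obtains p where "1 \<le> p" "p \<le> card (cycle n w)" "\<And>i. i + p < n \<Longrightarrow> w ! (i + p) = w ! i"
proof -
  obtain x p where x: "window x 0 n = w" "1 \<le> p" "p \<le> card (cycle n w)"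
    and per: "\<And>t::nat. window x (int (t + p)) n = window x (int t) n"
    using cyclicE[OF assms] by metis
  have "w ! (i + p) = w ! i" if "i + p < n" for i
  proof -
    have "w ! (i + p) = window x (int (0 + p)) n ! i"
      using that by (simp add: add.commute flip: x(1))
    also have "\<dots> = w ! i"
      using per[of 0] x(1) by simp
    finally show ?thesis .
  qed
  then show ?thesis
    using that x by blast
qed

section \<open>Counting the cycles by size\<close>

definition cycles :: "nat \<Rightarrow> 'a list set set" where
  "cycles n = cycle n ` cyclic n"

lemma finite_cycles: "finite (cycles n)"
  unfolding cycles_def using finite_subset[OF cyclic_subset_language finite_language] by blast

text \<open>Words on cycles of size less than \<open>2 * 2 ^ j\<close> have a period below that bound, so they are determined by their
  first \<open>4 * 2 ^ j\<close> letters.\<close>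

lemma card_cycles_of_size_le:
  fixes B :: real
  assumes B: "complexity X (min n (4 * 2 ^ j)) \<le> B * 2 ^ j"
  shows "card {c \<in> cycles n. floor_log (card c) = j} \<le> B"
proof -
  let ?C = "{c \<in> cycles n. floor_log (card c) = j}"
  have mem: "w \<in> cyclic n \<and> cycle n w = c" if c: "c \<in> ?C" "w \<in> c" for c w
  proof -
    obtain v where "v \<in> cyclic n" "c = cycle n v"
      using c(1) by (auto simp: cycles_def)
    with c(2) show ?thesis
      using cycle_eq[of v n w] by simp
  qed
  have size: "2 ^ j \<le> card c" "card c < 2 * 2 ^ j" if "c \<in> ?C" for c
  proof -
    obtain w where w: "w \<in> cyclic n" "c = cycle n w" "floor_log (card c) = j"
      using \<open>c \<in> ?C\<close> by (auto simp: cycles_def)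
    then have "card c > 0"
      using self_in_cycle[OF w(1)] finite_cycle[of n w] by (auto simp: card_gt_0_iff)
    then show "2 ^ j \<le> card c" "card c < 2 * 2 ^ j"
      using floor_log_exp2_le[of "card c"] floor_log_exp2_gt[of "card c"] w by auto
  qed
  have fin: "finite ?C" "\<And>c. c \<in> ?C \<Longrightarrow> finite c"
    using finite_cycles finite_cycle by (auto simp: cycles_def)
  \<comment> \<open>The cycles are disjoint with at least \<open>2 ^ j\<close> words each, so their
    number is controlled by the number of words on them.\<close>
  have "card ?C * 2 ^ j \<le> (\<Sum>c\<in>?C. card c)"
    using sum_bounded_below[of ?C "2 ^ j" card] size by simp
  also have "\<dots> = card (\<Union>?C)"
  proof (rule card_Union_disjoint[symmetric])
    show "disjoint ?C"
      unfolding pairwise_def disjnt_def using mem by blast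
  qed (rule fin(2))
  also have "\<dots> \<le> complexity X (min n (4 * 2 ^ j))"
    unfolding complexity_def
  proof (rule card_inj_on_le)
    show "inj_on (take (4 * 2 ^ j)) (\<Union>?C)"
    proof (rule inj_onI)
      fix u v assume uv: "u \<in> \<Union>?C" "v \<in> \<Union>?C" and eq: "take (4 * 2 ^ j) u = take (4 * 2 ^ j) v"
      obtain c d where c: "u \<in> cyclic n" "cycle n u = c" "c \<in> ?C" 
        and d: "v \<in> cyclic n" "cycle n v = d" "d \<in> ?C"
      proof -
        from uv(1) obtain c where "u \<in> c" "c \<in> ?C"
          by (rule UnionE)
        moreover from uv(2) obtain d where "v \<in> d" "d \<in> ?C"
          by (rule UnionE)
        ultimately show ?thesis
          using that[of c d] mem[of c u] mem[of d v] by simp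
      qed
      obtain p where p: "1 \<le> p" "p \<le> card c" "\<And>i. i + p < n \<Longrightarrow> u ! (i + p) = u ! i"
        using cyclic_period[OF c(1)] c by metis
      obtain q where q: "1 \<le> q" "q \<le> card d" "\<And>i. i + q < n \<Longrightarrow> v ! (i + q) = v ! i"
        using cyclic_period[OF d(1)] d by metis
      have len: "length u = n" "length v = n"
        using c(1) d(1) cyclic_subset_language by (auto simp: language_def)
      show "u = v"
      proof (rule weak_Fine_Wilf[OF len p(1) q(1) p(3) q(3)])
        fix i assume "i < n" "i < p + q"
        then have "i < 4 * 2 ^ j"
          using p(2) q(2) size(2)[OF c(3)] size(2)[OF d(3)] by linarith
        then show "u ! i = v ! i"
          using eq by (metis nth_take)
      qed
    qed
    have "\<Union>?C \<subseteq> language X n"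
      using cycle_subset_language by (auto simp: cycles_def)
    then show "take (4 * 2 ^ j) ` \<Union>?C \<subseteq> language X (min n (4 * 2 ^ j))"
      by (auto simp: language_eq take_window min.commute)
  qed (rule finite_language)
  finally have "real (card ?C * 2 ^ j) \<le> B * 2 ^ j"
    using B by linarith
  then show ?thesis
    by simp
qed

text \<open>Cycle sizes are at most \<open>complexity X n\<close>, so \<open>floor_log\<close> sorts
  the cycles into \<open>floor_log (complexity X n) + 1\<close> dyadic classes of at most
  \<open>B\<close> members each.\<close>

lemma card_cycles_le:
  fixes B :: real
  assumes B: "\<And>q. q \<ge> 1 \<Longrightarrow> complexity X (min n (4 * q)) \<le> B * q"
  shows "card (cycles n) \<le> B * (floor_log (complexity X n) + 1)"
proof -
  let ?J = "{..floor_log (complexity X n)}"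
  have "(\<lambda>c. floor_log (card c)) ` cycles n \<subseteq> ?J"
    by (auto simp: cycles_def intro!: floor_log_le_iff card_cycle_le)
  then have "card (cycles n) = (\<Sum>j\<in>?J. card {c \<in> cycles n. floor_log (card c) = j})"
    using sum.group[OF finite_cycles finite_atMost, of "\<lambda>c. floor_log (card c)" n _ "\<lambda>_. 1::nat"] by simp
  also have "real \<dots> \<le> (\<Sum>j\<in>?J. B)"
    unfolding of_nat_sum by (intro sum_mono card_cycles_of_size_le) (use B[of "2 ^ _"] in simp)
  finally show ?thesis
    by (simp add: algebra_simps)
qed

section \<open>Covers of the language by few points\<close>

definition covers :: "nat \<Rightarrow> nat \<Rightarrow> (int \<Rightarrow> 'a) set \<Rightarrow> bool" where
  "covers n N Y \<longleftrightarrow> finite Y \<and> Y \<subseteq> X \<and> (\<forall>w\<in>language X n. \<exists>y\<in>Y. \<exists>j\<le>N. window y (int j) n = w)"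

text \<open>One point through each branch shows the words forced by it, and one point on each cycle
  shows all its words within a period. By \<open>cyclic_or_after_branch\<close> this reaches every
  word.\<close>

lemma exists_cover:
  fixes B :: real
  assumes B: "\<And>q. q \<ge> 1 \<Longrightarrow> complexity X (min n (4 * q)) \<le> B * q"
  shows "\<exists>Y. covers n (complexity X n) Y \<and> 
    card Y \<le> 2 * (complexity X (Suc n) - real (complexity X n)) + B * (floor_log (complexity X n) + 1)"
proof -
  have "\<exists>y. y \<in> X \<and> window y 0 (Suc n) = e" if "e \<in> branches n" for e
  proof -
    have "e \<in> (\<lambda>x. window x 0 (Suc n)) ` X"
      using that unfolding branches_def language_eq by simp
    then show ?thesis
      by blast
  qed
  then obtain f where f: "\<And>e. e \<in> branches n \<Longrightarrow> f e \<in> X \<and> window (f e) 0 (Suc n) = e"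
    by metis
  have "\<exists>y. y \<in> X \<and> (\<forall>w\<in>c. \<exists>j\<le>complexity X n. window y (int j) n = w)" if "c \<in> cycles n" for c
  proof -
    obtain w where w: "w \<in> cyclic n" "c = cycle n w"
      using \<open>c \<in> cycles n\<close> by (auto simp: cycles_def)
    obtain x p where x: "x \<in> X" "1 \<le> p" "p \<le> card (cycle n w)"
      and per: "\<And>t::nat. window x (int (t + p)) n = window x (int t) n"
      and cyc: "cycle n w = range (\<lambda>t::nat. window x (int t) n)"
      using cyclicE[OF w(1)] by metis
    have "\<exists>j\<le>complexity X n. window x (int j) n = u" if u: "u \<in> c" for u
    proof -
      obtain t where t: "u = window x (int t) n"
        using u w cyc by auto
      have "window x (int (s + m * p)) n = window x (int s) n" for s m
      proof (induction m)
        case (Suc m)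
        then show ?case
          using per[of "s + m * p"] by (simp add: algebra_simps)
      qed simp
      from this[of "t mod p" "t div p"] have "window x (int (t mod p)) n = u"
        using t by simp
      moreover have "t mod p \<le> p"
        using x(2) by (simp add: less_imp_le)
      moreover have "p \<le> complexity X n"
        using x(3) card_cycle_le[of n w] by linarith
      ultimately show ?thesis
        using order_trans by blast
    qed
    then show ?thesis
      using x(1) by blast
  qed
  then obtain g where g: "\<And>c. c \<in> cycles n \<Longrightarrow>
      g c \<in> X \<and> (\<forall>w\<in>c. \<exists>j\<le>complexity X n. window (g c) (int j) n = w)"
    by metis
  let ?Y = "f ` branches n \<union> g ` cycles n"
  have finb: "finite (branches n)"
    using finite_language[of "Suc n"] by (auto simp: branches_def)
  have "\<exists>y\<in>?Y. \<exists>j\<le>complexity X n. window y (int j) n = w" if "w \<in> language X n" for w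
    using cyclic_or_after_branch[OF that]
  proof
    assume "w \<in> cyclic n"
    then have "cycle n w \<in> cycles n" "w \<in> cycle n w"
      using self_in_cycle by (auto simp: cycles_def)
    then show ?thesis
      using g by blast
  next
    assume "\<exists>e\<in>branches n. \<exists>j\<le>complexity X n. \<forall>y\<in>X. \<forall>k.
      window y k (Suc n) = e \<longrightarrow> window y (k + int j) n = w"
    then obtain e j where e: "e \<in> branches n" "j \<le> complexity X n"
      "\<And>y k. \<lbrakk>y \<in> X; window y k (Suc n) = e\<rbrakk> \<Longrightarrow> window y (k + int j) n = w"
      by blast
    then have "window (f e) (int j) n = w"
      using e(3)[of "f e" 0] f[of e] by simp
    then show ?thesis
      using e by blast
  qed
  then have "covers n (complexity X n) ?Y"
    unfolding covers_def using f g finb finite_cycles by auto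
  moreover have "card ?Y \<le> card (branches n) + card (cycles n)"
    using card_Un_le[of "f ` branches n" "g ` cycles n"] card_image_le[OF finb, of f]
      card_image_le[OF finite_cycles, of g n] by linarith
  moreover have "real (card (branches n)) \<le> 2 * (complexity X (Suc n) - real (complexity X n))"
  proof -
    have "real (card (branches n) + 2 * complexity X n) \<le> real (2 * complexity X (Suc n))"
      using card_branches_le by (simp only: of_nat_le_iff)
    then show ?thesis
      by simp
  qed
  ultimately show ?thesis
    using card_cycles_le[OF B] by (intro exI[of _ ?Y]) auto
qed

end

section \<open>Automorphisms as block codes\<close>

lemma topspace_full_shift: "topspace (full_shift A) = PiE UNIV (\<lambda>_. A)"
  by (simp add: full_shift_def)

lemma compact_space_full_shift: "finite A \<Longrightarrow> compact_space (full_shift A)"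
  by (simp add: full_shift_def compact_space_product_topology compact_space_discrete_topology)

lemma openin_full_shift_cylinder:
  assumes "finite I" "x \<in> topspace (full_shift A)"
  shows "openin (full_shift A) {y \<in> topspace (full_shift A). \<forall>i\<in>I. y i = x i}"
proof -
  let ?U = "\<lambda>i. if i \<in> I then {x i} else A"
  have "PiE UNIV ?U = {y \<in> topspace (full_shift A). \<forall>i\<in>I. y i = x i}"
    using assms(2) by (auto simp: topspace_full_shift PiE_iff split: if_splits)
  moreover have "openin (full_shift A) (PiE UNIV ?U)"
    unfolding full_shift_def
  proof (rule product_topology_basis)
    show "finite {i. ?U i \<noteq> topspace (discrete_topology A)}"
      using assms(1) by (rule rev_finite_subset) auto
  qed (use assms(2) in \<open>auto simp: topspace_full_shift PiE_iff\<close>)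
  ultimately show ?thesis
    by simp
qed

lemma openin_full_shift_contains_cylinder:
  assumes "openin (full_shift A) U" "x \<in> U"
  obtains r :: nat where "\<And>y. \<lbrakk>y \<in> topspace (full_shift A); \<And>i. \<bar>i\<bar> \<le> int r \<Longrightarrow> y i = x i\<rbrakk> \<Longrightarrow> y \<in> U"
proof -
  obtain V where V: "finite {i. V i \<noteq> A}" "\<And>i. V i \<subseteq> A" "x \<in> PiE UNIV V" "PiE UNIV V \<subseteq> U"
    using assms unfolding full_shift_def openin_product_topology_alt by auto
  define r where "r = Max (insert 0 ((\<lambda>i. nat \<bar>i\<bar>) ` {i. V i \<noteq> A}))"
  have r: "\<bar>i\<bar> \<le> int r" if "V i \<noteq> A" for i
  proof -
    have "nat \<bar>i\<bar> \<le> r"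
      unfolding r_def using V(1) that by (intro Max_ge) auto
    then show ?thesis
      by simp
  qed
  have "y \<in> U" if y: "y \<in> topspace (full_shift A)" "\<And>i. \<bar>i\<bar> \<le> int r \<Longrightarrow> y i = x i" for y
  proof -
    have "y i \<in> V i" for i
    proof (cases "V i = A")
      case False
      then show ?thesis
        using y(2)[OF r] V(3) by (auto simp: PiE_iff)
    qed (use y(1) in \<open>auto simp: topspace_full_shift PiE_iff\<close>)
    then show ?thesis
      using V(4) by (auto simp: PiE_iff)
  qed
  then show ?thesis
    using that by blast
qed

section \<open>The automorphism group of a subshift\<close>

locale finite_subshift =
  fixes A :: "'a set" and X :: "(int \<Rightarrow> 'a) set"
  assumes finite_A: "finite A" and subshift: "subshift A X"
begin

lemma X_subset: "X \<subseteq> topspace (full_shift A)"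
  using subshift closedin_subset by (auto simp: subshift_def)

sublocale shift_space A X
proof
  show "x i \<in> A" if "x \<in> X" for x i
    using that X_subset by (auto simp: topspace_full_shift PiE_iff)
qed (use finite_A subshift in \<open>auto simp: subshift_def\<close>)

abbreviation X_top :: "(int \<Rightarrow> 'a) topology" where
  "X_top \<equiv> subtopology (full_shift A) X"

abbreviation G :: "((int \<Rightarrow> 'a) \<Rightarrow> (int \<Rightarrow> 'a)) monoid" where
  "G \<equiv> aut_group A X"

lemma topspace_Int_X [simp]: "topspace (full_shift A) \<inter> X = X"
  using X_subset by auto

lemma topspace_top: "topspace X_top = X"
  by simp

lemma compact_top: "compact_space X_top"
  using closedin_compact_space[OF compact_space_full_shift[OF finite_A]] subshift
  by (simp add: subshift_def compact_space_subtopology)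

text \<open>A homeomorphism of \<open>X_top\<close> is a bijection of \<open>X\<close>, so only
  extensionality remains of membership in \<open>Bij X\<close>.\<close>

lemma aut_iff: "\<phi> \<in> carrier G \<longleftrightarrow> \<phi> \<in> extensional X \<and> homeomorphic_map X_top X_top \<phi> \<and>
    (\<forall>x\<in>X. \<phi> (shift x) = shift (\<phi> x))"
  by (auto simp: aut_group_def Bij_def bij_betw_def homeomorphic_eq_everything_map)

lemma aut_in: "\<lbrakk>\<phi> \<in> carrier G; x \<in> X\<rbrakk> \<Longrightarrow> \<phi> x \<in> X"
  by (auto simp: aut_iff homeomorphic_eq_everything_map)

lemma shift_in: "x \<in> X \<Longrightarrow> shift x \<in> X"
  using shift_image by blast

lemma aut_Bij: "\<phi> \<in> carrier G \<Longrightarrow> \<phi> \<in> Bij X"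
  by (simp add: aut_group_def)

lemma mult_aut: "\<lbrakk>\<phi> \<in> carrier G; \<psi> \<in> carrier G\<rbrakk> \<Longrightarrow> \<phi> \<otimes>\<^bsub>G\<^esub> \<psi> = compose X \<phi> \<psi>"
  using aut_Bij[of \<phi>] aut_Bij[of \<psi>] by (simp add: aut_group_def BijGroup_def)

lemma one_aut: "\<one>\<^bsub>G\<^esub> = (\<lambda>x\<in>X. x)"
  by (simp add: aut_group_def BijGroup_def)

lemma group_aut: "group G"
proof -
  have eq: "G = BijGroup X\<lparr>carrier := carrier G\<rparr>"
    by (simp add: aut_group_def)
  have "subgroup (carrier G) (BijGroup X)"
  proof
    show "carrier G \<subseteq> carrier (BijGroup X)"
      using aut_Bij by (auto simp: BijGroup_def)
    show "\<one>\<^bsub>BijGroup X\<^esub> \<in> carrier G"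
    proof -
      have "homeomorphic_map X_top X_top (\<lambda>x\<in>X. x)"
        by (rule homeomorphic_map_eq[of _ _ id]) (auto simp: homeomorphic_map_id)
      then show ?thesis
        using shift_in by (auto simp: BijGroup_def aut_iff)
    qed
  next
    fix \<phi> \<psi> assume \<phi>: "\<phi> \<in> carrier G" and \<psi>: "\<psi> \<in> carrier G"
    have "homeomorphic_map X_top X_top (\<phi> \<circ> \<psi>)"
      using \<phi> \<psi> by (auto simp: aut_iff intro: homeomorphic_map_compose)
    then have "homeomorphic_map X_top X_top (compose X \<phi> \<psi>)"
      by (rule homeomorphic_map_eq) (simp add: compose_def)
    then have "compose X \<phi> \<psi> \<in> carrier G"
      using \<phi> \<psi> aut_in[OF \<psi>] shift_in by (auto simp: aut_iff compose_def)
    then show "\<phi> \<otimes>\<^bsub>BijGroup X\<^esub> \<psi> \<in> carrier G"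
      using aut_Bij[OF \<phi>] aut_Bij[OF \<psi>] by (simp add: BijGroup_def)
  next
    fix \<phi> assume \<phi>: "\<phi> \<in> carrier G"
    obtain \<psi> where "homeomorphic_maps X_top X_top \<phi> \<psi>"
      using \<phi> unfolding aut_iff homeomorphic_map_maps by blast
    then have \<psi>: "homeomorphic_map X_top X_top \<psi>" "\<And>x. x \<in> X \<Longrightarrow> \<psi> (\<phi> x) = x"
        "\<And>x. x \<in> X \<Longrightarrow> \<phi> (\<psi> x) = x"
      by (simp_all add: homeomorphic_maps_map)
    have \<psi>_in: "\<psi> x \<in> X" if "x \<in> X" for x
      using \<psi>(1) that by (auto simp: homeomorphic_eq_everything_map)
    have inj: "inj_on \<phi> X"
      using \<phi> by (simp add: aut_iff homeomorphic_eq_everything_map)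
    \<comment> \<open>This is the inverse in \<open>BijGroup X\<close>; on \<open>X\<close> it
      agrees with the continuous inverse \<open>\<psi>\<close>.\<close>
    let ?inv = "\<lambda>x\<in>X. inv_into X \<phi> x"
    have inv: "?inv x = \<psi> x" if "x \<in> X" for x
      using inv_into_f_f[OF inj \<psi>_in[OF that]] \<psi>(3)[OF that] that by simp
    have "homeomorphic_map X_top X_top ?inv"
      using \<psi>(1) by (rule homeomorphic_map_eq) (use inv in simp)
    moreover have "\<psi> (shift x) = shift (\<psi> x)" if "x \<in> X" for x
    proof -
      have "\<phi> (shift (\<psi> x)) = shift x"
        using \<phi> \<psi>_in[OF that] \<psi>(3)[OF that] by (simp add: aut_iff)
      then show ?thesis
        using \<psi>(2)[OF shift_in[OF \<psi>_in[OF that]]] by simp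
    qed
    then have "?inv (shift x) = shift (?inv x)" if "x \<in> X" for x
      using that inv[OF that] inv[OF shift_in[OF that]] by simp
    ultimately have "?inv \<in> carrier G"
      unfolding aut_iff by blast
    then show "inv\<^bsub>BijGroup X\<^esub> \<phi> \<in> carrier G"
      using inv_BijGroup[OF aut_Bij[OF \<phi>]] by simp
  qed
  from subgroup.subgroup_is_group[OF this group_BijGroup] show ?thesis
    using eq by simp
qed

section \<open>Finite range of automorphisms\<close>

lemma aut_translate:
  assumes "\<phi> \<in> carrier G" "x \<in> X"
  shows "\<phi> (translate c x) = translate c (\<phi> x)"
proof (induction c rule: int_induct[of _ 0])
  case (step1 i)
  have "\<phi> (translate (i + 1) x) = \<phi> (shift (translate i x))"
    by (simp add: add.commute flip: translate_shift)
  also have "\<dots> = shift (\<phi> (translate i x))"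
    using assms translate_in by (simp add: aut_iff)
  finally show ?case
    using step1 by (simp add: add.commute flip: translate_shift)
next
  case (step2 i)
  have "shift (\<phi> (translate (i - 1) x)) = \<phi> (shift (translate (i - 1) x))"
    using assms translate_in by (simp add: aut_iff)
  also have "\<dots> = translate i (\<phi> x)"
    using step2 by (simp flip: translate_shift)
  finally have "translate (- 1) (translate 1 (\<phi> (translate (i - 1) x))) = translate (- 1) (translate i (\<phi> x))"
    by (simp only: translate_shift)
  then show ?case
    by simp
qed simp

text \<open>Only coordinate \<open>0\<close> is tested; for automorphisms, commutation with the
  shift transfers the property to every coordinate.\<close>

definition has_range :: "((int \<Rightarrow> 'a) \<Rightarrow> (int \<Rightarrow> 'a)) \<Rightarrow> nat \<Rightarrow> bool" where
  "has_range \<phi> r \<longleftrightarrow> (\<forall>x\<in>X. \<forall>y\<in>X. (\<forall>i. \<bar>i\<bar> \<le> int r \<longrightarrow> x i = y i) \<longrightarrow> \<phi> x 0 = \<phi> y 0)"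

lemma has_range_mono:
  assumes "has_range \<phi> r" "r \<le> s"
  shows "has_range \<phi> s"
proof -
  have "\<bar>i\<bar> \<le> int s" if "\<bar>i\<bar> \<le> int r" for i
    using assms(2) that by linarith
  then show ?thesis
    using assms(1) unfolding has_range_def by blast
qed

text \<open>By continuity, \<open>\<phi> x 0\<close> is constant on a cylinder around each point. By
  compactness finitely many of these cylinders cover \<open>X\<close>, and their largest radius is a
  range.\<close>

lemma Curtis_Hedlund_Lyndon:
  assumes "\<phi> \<in> carrier G"
  shows "\<exists>r. has_range \<phi> r"
proof -
  let ?T = "topspace (full_shift A)"
  define cyl where "cyl x r = X \<inter> {y \<in> ?T. \<forall>i\<in>{- int r..int r}. y i = x i}" for x and r :: nat
  have cont: "continuous_map X_top X_top \<phi>"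
    using assms by (auto simp: aut_iff homeomorphic_eq_everything_map)
  have "\<exists>r. \<forall>y\<in>cyl x r. \<phi> y 0 = \<phi> x 0" if "x \<in> X" for x
  proof -
    let ?V = "{y \<in> ?T. \<forall>i\<in>{0}. y i = \<phi> x i}"
    have "openin X_top (X \<inter> ?V)"
      using openin_full_shift_cylinder[of "{0}" "\<phi> x" A] aut_in[OF assms that] X_subset
      by (intro openin_subtopology_Int2) auto
    then have "openin X_top {y \<in> topspace X_top. \<phi> y \<in> X \<inter> ?V}"
      using cont openin_continuous_map_preimage by blast
    then obtain U where U: "openin (full_shift A) U" "{y \<in> X. \<phi> y \<in> X \<inter> ?V} = X \<inter> U"
      unfolding openin_subtopology topspace_top by blast
    have "x \<in> {y \<in> X. \<phi> y \<in> X \<inter> ?V}"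
      using that aut_in[OF assms that] X_subset by auto
    then have "x \<in> U"
      using U by blast
    obtain r where r: "\<And>y. \<lbrakk>y \<in> ?T; \<And>i. \<bar>i\<bar> \<le> int r \<Longrightarrow> y i = x i\<rbrakk> \<Longrightarrow> y \<in> U"
      using openin_full_shift_contains_cylinder[OF U(1) \<open>x \<in> U\<close>] by blast
    have "\<phi> y 0 = \<phi> x 0" if y: "y \<in> cyl x r" for y
    proof -
      have "y \<in> U"
        using y by (intro r) (auto simp: cyl_def abs_le_iff)
      then have "y \<in> {y \<in> X. \<phi> y \<in> X \<inter> ?V}"
        using y U(2) by (simp add: cyl_def)
      then show ?thesis
        by simp
    qed
    then show ?thesis
      by blast
  qed
  then obtain \<rho> where \<rho>: "\<And>x y. \<lbrakk>x \<in> X; y \<in> cyl x (\<rho> x)\<rbrakk> \<Longrightarrow> \<phi> y 0 = \<phi> x 0"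
    by metis
  let ?\<U> = "(\<lambda>x. cyl x (\<rho> x)) ` X"
  have "openin X_top U" if "U \<in> ?\<U>" for U
    using that X_subset unfolding cyl_def
    by (auto intro!: openin_subtopology_Int2 openin_full_shift_cylinder)
  moreover have "topspace X_top \<subseteq> \<Union>?\<U>"
    using X_subset by (auto simp: cyl_def)
  ultimately obtain \<F> where \<F>: "finite \<F>" "\<F> \<subseteq> ?\<U>" "X \<subseteq> \<Union>\<F>"
    using compact_top unfolding compact_space_alt topspace_top by meson
  obtain C where C: "C \<subseteq> X" "finite C" "\<F> = (\<lambda>x. cyl x (\<rho> x)) ` C"
    using finite_subset_image[OF \<F>(1,2)] by blast
  \<comment> \<open>The \<open>0\<close> serves the case of empty \<open>X\<close>.\<close>
  define R where "R = Max (insert 0 (\<rho> ` C))"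
  have R: "\<rho> z \<le> R" if "z \<in> C" for z
    unfolding R_def using C(2) that by (intro Max_ge) auto
  have "\<phi> x 0 = \<phi> y 0" if xy: "x \<in> X" "y \<in> X" "\<And>i. \<bar>i\<bar> \<le> int R \<Longrightarrow> x i = y i" for x y
  proof -
    have "x \<in> (\<Union>x\<in>C. cyl x (\<rho> x))"
      using subsetD[OF \<F>(3) xy(1)] C(3) by simp
    then obtain z where z: "z \<in> C" "x \<in> cyl z (\<rho> z)"
      by (rule UN_E)
    have "y i = z i" if "i \<in> {- int (\<rho> z)..int (\<rho> z)}" for i
      using xy(3)[of i] R[OF z(1)] z(2) that by (auto simp: cyl_def)
    then have "y \<in> cyl z (\<rho> z)"
      using xy(2) X_subset by (auto simp: cyl_def)
    then show ?thesis
      using \<rho>[of z x] \<rho>[of z y] z C(1) by auto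
  qed
  then show ?thesis
    unfolding has_range_def by blast
qed

text \<open>The first \<open>2 * r + 1\<close> letters of the window at \<open>i\<close> are the
  coordinates within distance \<open>r\<close> of \<open>i + r\<close>, and these determine the
  value there.\<close>

lemma aut_eq_if_window_eq:
  assumes \<phi>: "\<phi> \<in> carrier G" "has_range \<phi> r" and n: "2 * r + 1 \<le> n"
    and xy: "x \<in> X" "y \<in> X" "window x i n = window y k n"
  shows "\<phi> x (i + int r) = \<phi> y (k + int r)"
proof -
  let ?x = "translate (i + int r) x" and ?y = "translate (k + int r) y"
  have "?x j = ?y j" if "\<bar>j\<bar> \<le> int r" for j
  proof -
    define m where "m = nat (j + int r)"
    have m: "j + int r = int m"
      using \<open>\<bar>j\<bar> \<le> int r\<close> by (simp add: m_def)
    then have "m < n"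
      using n \<open>\<bar>j\<bar> \<le> int r\<close> by linarith
    then have "x (i + int m) = y (k + int m)"
      using xy(3) unfolding window_eq_iff by blast
    moreover have "j + (i + int r) = i + int m" "j + (k + int r) = k + int m"
      using m by auto
    ultimately show ?thesis
      by (simp only: translate_def)
  qed
  then have "\<phi> ?x 0 = \<phi> ?y 0"
    using \<phi>(2) translate_in[OF xy(1)] translate_in[OF xy(2)] unfolding has_range_def by blast
  then show ?thesis
    using aut_translate[OF \<phi>(1)] xy by (simp add: translate_def)
qed

text \<open>Knowing \<open>\<psi> x\<close> within distance \<open>r\<close> of \<open>0\<close>
  takes only the coordinates of \<open>x\<close> within distance \<open>r + s\<close>.\<close>

lemma has_range_compose:
  assumes \<phi>: "\<phi> \<in> carrier G" "has_range \<phi> r" and \<psi>: "\<psi> \<in> carrier G" "has_range \<psi> s"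
  shows "has_range (\<phi> \<otimes>\<^bsub>G\<^esub> \<psi>) (r + s)"
  unfolding has_range_def
proof (intro ballI impI)
  fix x y assume xy: "x \<in> X" "y \<in> X" "\<forall>i. \<bar>i\<bar> \<le> int (r + s) \<longrightarrow> x i = y i"
  have "\<psi> x i = \<psi> y i" if "\<bar>i\<bar> \<le> int r" for i
  proof -
    have "window x (i - int s) (2 * s + 1) = window y (i - int s) (2 * s + 1)"
      unfolding window_eq_iff using xy(3) that by auto
    then show ?thesis
      using aut_eq_if_window_eq[OF \<psi>, of "2 * s + 1" x y "i - int s" "i - int s"] xy by simp
  qed
  then have "\<phi> (\<psi> x) 0 = \<phi> (\<psi> y) 0"
    using \<phi>(2) aut_in[OF \<psi>(1)] xy unfolding has_range_def by blast
  then show "(\<phi> \<otimes>\<^bsub>G\<^esub> \<psi>) x 0 = (\<phi> \<otimes>\<^bsub>G\<^esub> \<psi>) y 0"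
    using xy by (simp add: mult_aut[OF \<phi>(1) \<psi>(1)] compose_def)
qed

lemma has_range_word_ball:
  assumes S: "finite S" "S \<subseteq> carrier G" "\<And>s. s \<in> S \<Longrightarrow> has_range s R" and "\<phi> \<in> word_ball G S k"
  shows "has_range \<phi> (k * R)"
  using assms(4)
proof (induction k arbitrary: \<phi>)
  case 0
  then show ?case
    by (auto simp: one_aut has_range_def)
next
  case (Suc k)
  then consider "\<phi> \<in> word_ball G S k"
    | s \<psi> where "s \<in> S" "\<psi> \<in> word_ball G S k" "\<phi> = s \<otimes>\<^bsub>G\<^esub> \<psi>"
    by (auto simp: l_coset_def)
  then show ?case
  proof cases
    case 1
    then show ?thesis
      by (intro has_range_mono[OF Suc.IH]) auto
  next
    case 2
    then have "\<psi> \<in> carrier G"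
      using group.word_ball_subset[OF group_aut S(1,2)] by blast
    then show ?thesis
      using has_range_compose[of s R \<psi> "k * R"] 2 S Suc.IH by auto
  qed
qed

text \<open>An automorphism of range \<open>r\<close> is determined by the words of length \<open>Suc N\<close> that its values on \<open>Y\<close>
  show at position \<open>r\<close>, because each window that it reads occurs in some element of \<open>Y\<close>.\<close>

lemma card_bounded_range_le:
  assumes Y: "covers n N Y" and n: "2 * r + 1 \<le> n"
    and \<Phi>: "\<Phi> \<subseteq> carrier G" "\<And>\<phi>. \<phi> \<in> \<Phi> \<Longrightarrow> has_range \<phi> r"
  shows "finite \<Phi>" "card \<Phi> \<le> complexity X (Suc N) ^ card Y"
proof -
  \<comment> \<open>The window at \<open>j\<close> determines the value at \<open>j + r\<close>, and
    \<open>j\<close> runs from \<open>0\<close> to \<open>N\<close>; hence the offset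
    \<open>r\<close> and the length \<open>Suc N\<close>.\<close>
  let ?f = "\<lambda>\<phi>. \<lambda>y\<in>Y. window (\<phi> y) (int r) (Suc N)"
  let ?W = "PiE Y (\<lambda>_. language X (Suc N))"
  have YX: "finite Y" "Y \<subseteq> X"
    using Y by (auto simp: covers_def)
  have inj: "inj_on ?f \<Phi>"
  proof (rule inj_onI)
    fix \<phi> \<psi> assume \<phi>: "\<phi> \<in> \<Phi>" and \<psi>: "\<psi> \<in> \<Phi>" and eq: "?f \<phi> = ?f \<psi>"
    have "\<phi> x = \<psi> x" if x: "x \<in> X" for x
    proof
      fix i
      obtain y j where y: "y \<in> Y" "j \<le> N" "window y (int j) n = window x (i - int r) n"
        using Y window_in_language[OF x] unfolding covers_def by blast
      have "\<phi> x i = \<phi> y (int j + int r)"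
        using aut_eq_if_window_eq[of \<phi> r n x y "i - int r" "int j"] \<phi> \<Phi> n x y YX by auto
      moreover have "\<psi> x i = \<psi> y (int j + int r)"
        using aut_eq_if_window_eq[of \<psi> r n x y "i - int r" "int j"] \<psi> \<Phi> n x y YX by auto
      moreover have "window (\<phi> y) (int r) (Suc N) = window (\<psi> y) (int r) (Suc N)"
        using fun_cong[OF eq, of y] y(1) by simp
      then have "\<phi> y (int r + int j) = \<psi> y (int r + int j)"
        using y(2) unfolding window_eq_iff by auto
      ultimately show "\<phi> x i = \<psi> x i"
        by (simp add: add.commute)
    qed
    moreover have "\<phi> \<in> extensional X" "\<psi> \<in> extensional X"
      using \<phi> \<psi> \<Phi>(1) by (auto simp: aut_iff)
    ultimately show "\<phi> = \<psi>"
      by (intro extensionalityI[of _ X]) auto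
  qed
  have sub: "?f ` \<Phi> \<subseteq> ?W"
  proof
    fix g assume "g \<in> ?f ` \<Phi>"
    then obtain \<phi> where \<phi>: "\<phi> \<in> \<Phi>" "g = ?f \<phi>"
      by blast
    have "\<phi> \<in> carrier G"
      using \<Phi>(1) \<phi>(1) by (rule subsetD)
    then have "window (\<phi> y) (int r) (Suc N) \<in> language X (Suc N)" if "y \<in> Y" for y
      using window_in_language aut_in subsetD[OF YX(2) that] by blast
    then show "g \<in> ?W"
      unfolding \<phi>(2) by (rule restrict_PiE_iff[THEN iffD2, rule_format])
  qed
  have fin: "finite ?W"
    using YX finite_language by (intro finite_PiE) auto
  show "finite \<Phi>"
    using inj sub fin by (rule inj_on_finite)
  show "card \<Phi> \<le> complexity X (Suc N) ^ card Y"
    using card_inj_on_le[OF inj sub fin] YX by (simp add: card_PiE complexity_def)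
qed

text \<open>A finite cover for length \<open>2 * r + 1\<close> leaves only finitely many
  automorphisms of range \<open>r\<close>, and every automorphism has some range.\<close>

lemma countable_aut: "countable (carrier G)"
proof -
  have fin: "finite {\<phi> \<in> carrier G. has_range \<phi> r}" for r
  proof -
    let ?n = "2 * r + 1"
    \<comment> \<open>A crude constant suffices, since the cover only has to be finite.\<close>
    have "complexity X (min ?n (4 * q)) \<le> real (complexity X ?n) * q" if "q \<ge> 1" for q :: nat
    proof -
      have "complexity X (min ?n (4 * q)) * 1 \<le> complexity X ?n * q"
        using that by (intro mult_mono complexity_mono) auto
      then show ?thesis
        by (metis mult.right_neutral of_nat_le_iff of_nat_mult)
    qed
    then obtain Y where "covers ?n (complexity X ?n) Y"
      using exists_cover by blast
    then show ?thesis
      by (rule card_bounded_range_le(1)[of ?n _ _ r]) auto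
  qed
  have "carrier G = (\<Union>r. {\<phi> \<in> carrier G. has_range \<phi> r})"
    using Curtis_Hedlund_Lyndon by auto
  moreover have "countable (\<Union>r. {\<phi> \<in> carrier G. has_range \<phi> r})"
    by (rule countable_UN[OF countableI_type]) (rule countable_finite[OF fin])
  ultimately show ?thesis
    by simp
qed

end

section \<open>Growth of groups of automorphisms\<close>

context finite_subshift
begin

text \<open>Otherwise the increments over \<open>{N..<2 * N}\<close> would telescope to more than
  \<open>4 * C * N powr a\<close>, but \<open>complexity X (2 * N)\<close> is at most
  \<open>C * (2 * N) powr a\<close>. The factor \<open>4\<close> absorbs
  \<open>2 powr a\<close>.\<close>

lemma exists_small_increment:
  assumes bound: "\<And>n. n \<ge> 1 \<Longrightarrow> complexity X n \<le> C * real n powr a"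
    and a: "1 \<le> a" "a \<le> 2" and C: "C \<ge> 1" and N: "N \<ge> 1"
  obtains n where "N \<le> n"
    "complexity X (Suc n) - real (complexity X n) \<le> 4 * C * real n powr (a - 1)"
proof -
  have "\<exists>n\<in>{N..<2 * N}. complexity X (Suc n) - real (complexity X n) \<le> 4 * C * real n powr (a - 1)"
  proof (rule ccontr)
    assume "\<not> ?thesis"
    then have gt: "4 * C * real n powr (a - 1) < complexity X (Suc n) - real (complexity X n)"
      if "n \<in> {N..<2 * N}" for n
      using that by (auto simp: not_le)
    have "4 * C * real N powr a = (\<Sum>n\<in>{N..<2 * N}. 4 * C * real N powr (a - 1))"
      using N by (simp add: powr_diff)
    also have "\<dots> < (\<Sum>n\<in>{N..<2 * N}. complexity X (Suc n) - real (complexity X n))"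
    proof (rule sum_strict_mono)
      fix n assume n: "n \<in> {N..<2 * N}"
      have "4 * C * real N powr (a - 1) \<le> 4 * C * real n powr (a - 1)"
        using n C a by (intro mult_left_mono powr_mono2) auto
      then show "4 * C * real N powr (a - 1) < complexity X (Suc n) - real (complexity X n)"
        using gt[OF n] by linarith
    qed (use N in auto)
    also have "\<dots> = complexity X (2 * N) - real (complexity X N)"
      by (rule sum_Suc_diff') simp
    also have "\<dots> \<le> C * real (2 * N) powr a"
      using bound[of "2 * N"] N by simp
    also have "\<dots> = C * 2 powr a * real N powr a"
      by (simp add: powr_mult)
    also have "\<dots> \<le> C * 4 * real N powr a"
    proof -
      have "(2::real) powr a \<le> 2 powr 2"
        using a by (intro powr_mono) auto
      then show ?thesis
        using C by (intro mult_right_mono mult_left_mono) auto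
    qed
    finally show False
      by simp
  qed
  then show ?thesis
    using that by auto
qed

lemma floor_log_complexity_le:
  assumes "complexity X n \<le> C * real n ^ 2" "C \<ge> 1" "n \<ge> 1"
  shows "floor_log (complexity X n) \<le> log 2 (C * real n ^ 2)"
proof (cases "complexity X n = 0")
  case True
  \<comment> \<open>Since \<open>floor_log 0 = 0\<close>, it is enough that the logarithm on the
    right is nonnegative.\<close>
  have "1 * 1 \<le> C * real n ^ 2"
    using assms by (intro mult_mono) auto
  then show ?thesis
    using True by simp
next
  case False
  then have "2 ^ floor_log (complexity X n) \<le> complexity X n"
    by (intro floor_log_exp2_le) simp
  then have "2 ^ floor_log (complexity X n) \<le> real (complexity X n)"
    by (metis of_nat_le_iff of_nat_numeral of_nat_power)
  then have "2 ^ floor_log (complexity X n) \<le> C * real n ^ 2"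
    using assms by linarith
  then show ?thesis
    by (intro le_log_of_power) auto
qed

text \<open>\<open>B = 4 * C * n powr (a - 1)\<close> has two roles. It bounds the increment at
  \<open>n\<close>, so branches contribute at most \<open>2 * B\<close>. For
  \<open>m = min n (4 * q)\<close> it also gives \<open>C * m powr a \<le> B * q\<close>, so the
  cycles contribute \<open>B\<close> per dyadic class.\<close>

lemma exists_small_cover:
  assumes bound: "\<And>n. n \<ge> 1 \<Longrightarrow> complexity X n \<le> C * real n powr a"
    and a: "1 \<le> a" "a \<le> 2" and C: "C \<ge> 1" and N: "N \<ge> 1"
  obtains n Y where "N \<le> n" "covers n (complexity X n) Y"
    "card Y \<le> 4 * C * real n powr (a - 1) * (3 + log 2 (C * real n ^ 2))"
proof -
  obtain n where n: "N \<le> n"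
    "complexity X (Suc n) - real (complexity X n) \<le> 4 * C * real n powr (a - 1)"
    using exists_small_increment[OF assms] .
  let ?B = "4 * C * real n powr (a - 1)"
  have "complexity X (min n (4 * q)) \<le> ?B * q" if q: "q \<ge> 1" for q :: nat
  proof -
    let ?m = "min n (4 * q)"
    have m: "?m \<ge> 1"
      using n N q by simp
    then have "complexity X ?m \<le> C * real ?m powr a"
      by (rule bound)
    also have "\<dots> = C * (real ?m powr (a - 1) * real ?m)"
      using m by (simp add: powr_diff)
    also have "\<dots> \<le> C * (real n powr (a - 1) * (4 * real q))"
      using a C by (intro mult_left_mono mult_mono powr_mono2) auto
    finally show ?thesis
      by (simp add: algebra_simps)
  qed
  then obtain Y where Y: "covers n (complexity X n) Y"
    "card Y \<le> 2 * (complexity X (Suc n) - real (complexity X n)) + ?B * (floor_log (complexity X n) + 1)"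
    using exists_cover[of n ?B] by blast
  have "complexity X n \<le> C * real n ^ 2"
  proof -
    have "complexity X n \<le> C * real n powr a"
      using bound n N by simp
    also have "\<dots> \<le> C * real n powr 2"
      using C a n N by (intro mult_left_mono powr_mono) auto
    finally show ?thesis
      by simp
  qed
  then have "floor_log (complexity X n) \<le> log 2 (C * real n ^ 2)"
    using C n N by (intro floor_log_complexity_le) auto
  then have "?B * (floor_log (complexity X n) + 1) \<le> ?B * (log 2 (C * real n ^ 2) + 1)"
    using C by (intro mult_left_mono) auto
  with Y(2) n(2) have "card Y \<le> ?B * (3 + log 2 (C * real n ^ 2))"
    by (simp add: algebra_simps)
  with n(1) Y(1) show ?thesis
    using that by blast
qed

text \<open>The left side will be the logarithm of the bound on a word ball. It has order
  \<open>n powr (a - 1)\<close> times a squared logarithm, while the right side is linear in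
  \<open>n\<close> and \<open>a - 1 < 1\<close>.\<close>

lemma growth_estimate:
  fixes C a b c :: real
  assumes "C \<ge> 1" "a < 2" "b > 0" "c > 0"
  shows "eventually (\<lambda>n. 4 * C * real n powr (a - 1) * (3 + log 2 (C * real n ^ 2)) *
    ln (C * (C * real n ^ 2 + 1) ^ 2) < ((real n - 1) / c - 1) * b) sequentially"
  using assms unfolding log_def by real_asymp

text \<open>Elements of word length \<open>k\<close> have range \<open>k * R\<close>. For
  \<open>n\<close> about \<open>2 * k * R\<close>, their values on a small cover determine them, and
  \<open>growth_estimate\<close> puts the number of possible values below
  \<open>\<beta> ^ k\<close>.\<close>

lemma subexponential_growth:
  assumes bound: "\<And>n. n \<ge> 1 \<Longrightarrow> complexity X n \<le> C * real n powr a"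
    and a: "1 \<le> a" "a < 2" and C: "C \<ge> 1"
    and S: "finite S" "S \<subseteq> carrier G" and \<beta>: "\<beta> > 1"
  shows "\<exists>k. card (word_ball G S k) < (\<beta>::real) ^ k"
proof -
  obtain \<rho> where \<rho>: "\<And>s. s \<in> S \<Longrightarrow> has_range s (\<rho> s)"
    using Curtis_Hedlund_Lyndon S by (metis subsetD)
  \<comment> \<open>The \<open>1\<close> keeps the divisor \<open>2 * R\<close> positive.\<close>
  define R where "R = Max (insert 1 (\<rho> ` S))"
  have R: "R \<ge> 1" "\<And>s. s \<in> S \<Longrightarrow> \<rho> s \<le> R"
    unfolding R_def using S(1) by (auto intro!: Max_ge)
  have range: "has_range s R" if "s \<in> S" for s
    using has_range_mono[OF \<rho> R(2)] that by blast
  let ?L = "\<lambda>n. ln (C * (C * real n ^ 2 + 1) ^ 2)"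
  let ?M = "\<lambda>n. 4 * C * real n powr (a - 1) * (3 + log 2 (C * real n ^ 2))"
  obtain N where N: "\<And>n. n \<ge> N \<Longrightarrow> ?M n * ?L n < ((real n - 1) / (2 * R) - 1) * ln \<beta>"
    using growth_estimate[OF C a(2), of "ln \<beta>" "2 * real R"] \<beta> R
    by (auto simp: eventually_sequentially)
  obtain n Y where n: "max 1 N \<le> n" and Y: "covers n (complexity X n) Y" "card Y \<le> ?M n"
    by (rule exists_small_cover[OF bound, of "max 1 N"]) (use a C in auto)
  \<comment> \<open>The largest \<open>k\<close> for which windows of length \<open>n\<close> are
    long enough for range \<open>k * R\<close>.\<close>
  define k where "k = (n - 1) div (2 * R)"
  have kn: "2 * (k * R) + 1 \<le> n"
  proof -
    have "k * (2 * R) \<le> n - 1"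
      unfolding k_def by (rule div_times_less_eq_dividend)
    moreover have "k * (2 * R) = 2 * (k * R)"
      by simp
    ultimately show ?thesis
      using n by linarith
  qed
  have k: "(real n - 1) / (2 * R) - 1 \<le> k"
  proof -
    have "n - 1 < 2 * R + k * (2 * R)"
      unfolding k_def using R(1) by (intro dividend_less_div_times) simp
    then have "n \<le> 2 * R + k * (2 * R)"
      by linarith
    then have "real n \<le> real (2 * R + k * (2 * R))"
      by (simp only: of_nat_le_iff)
    then show ?thesis
      using R(1) by (simp add: field_simps)
  qed
  have sq: "complexity X m \<le> C * real m ^ 2" if "m \<ge> 1" for m
  proof -
    have "complexity X m \<le> C * real m powr a"
      using bound that by simp
    also have "\<dots> \<le> C * real m powr 2"
      using C a that by (intro mult_left_mono powr_mono) auto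
    finally show ?thesis
      using that by simp
  qed
  \<comment> \<open>Positions in the cover go up to \<open>complexity X n\<close>, so the recorded
    words have length one more; the quadratic bound is applied twice.\<close>
  have "complexity X (Suc (complexity X n)) \<le> C * real (Suc (complexity X n)) ^ 2"
    by (rule sq) simp
  also have "\<dots> \<le> C * (C * real n ^ 2 + 1) ^ 2"
    using sq[of n] n C by (intro mult_left_mono power_mono) auto
  finally have P: "complexity X (Suc (complexity X n)) \<le> C * (C * real n ^ 2 + 1) ^ 2" .
  \<comment> \<open>This makes \<open>?L n\<close> nonnegative, so that \<open>card Y\<close> may be
    replaced by its upper bound in the exponent.\<close>
  have ge1: "1 \<le> C * (C * real n ^ 2 + 1) ^ 2"
    using mult_mono[of 1 C 1 "(C * real n ^ 2 + 1) ^ 2"] C by simp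
  have "card (word_ball G S k) \<le> complexity X (Suc (complexity X n)) ^ card Y"
    using has_range_word_ball[OF S range] group.word_ball_subset[OF group_aut S]
    by (intro card_bounded_range_le(2)[OF Y(1) kn]) auto
  then have "real (card (word_ball G S k)) \<le> real (complexity X (Suc (complexity X n))) ^ card Y"
    by (metis of_nat_le_iff of_nat_power)
  also have "\<dots> \<le> (C * (C * real n ^ 2 + 1) ^ 2) ^ card Y"
    using P by (intro power_mono) auto
  also have "\<dots> = exp (card Y * ?L n)"
    using ge1 by (simp add: exp_of_nat_mult)
  also have "\<dots> \<le> exp (?M n * ?L n)"
    using Y(2) ge1 by (intro exp_le_cancel_iff[THEN iffD2] mult_right_mono) auto
  also have "\<dots> < exp (((real n - 1) / (2 * R) - 1) * ln \<beta>)"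
    using N[of n] n by simp
  also have "\<dots> \<le> exp (k * ln \<beta>)"
    using k \<beta> by (intro exp_le_cancel_iff[THEN iffD2] mult_right_mono) auto
  also have "\<dots> = \<beta> ^ k"
    using \<beta> by (simp add: exp_of_nat_mult)
  finally show ?thesis
    by blast
qed

end

text \<open>Enlarging the constant absorbs the finitely many \<open>n\<close> before the asymptotic
  bound holds. The exponent is raised to at least \<open>1\<close> so that
  \<open>n powr (a - 1)\<close> is nondecreasing in later estimates.\<close>

lemma powr_bound_from_bigo:
  fixes f :: "nat \<Rightarrow> real"
  assumes "\<epsilon> > 0" "f \<in> O(\<lambda>n. real n powr (2 - \<epsilon>))"
  obtains C a where "C \<ge> 1" "1 \<le> a" "a < 2" "\<And>n. n \<ge> 1 \<Longrightarrow> f n \<le> C * real n powr a"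
proof -
  define a where "a = max 1 (2 - \<epsilon>)"
  obtain c where "c > 0" "eventually (\<lambda>n. norm (f n) \<le> c * norm (real n powr (2 - \<epsilon>))) sequentially"
    using landau_o.bigE[OF assms(2)] by blast
  then obtain N where N: "\<And>n. n \<ge> N \<Longrightarrow> f n \<le> c * real n powr (2 - \<epsilon>)"
    unfolding eventually_sequentially by (auto simp: abs_le_iff)
  define C where "C = Max (insert 1 (insert c (f ` {..<N})))"
  have C: "1 \<le> C" "c \<le> C" "\<And>n. n < N \<Longrightarrow> f n \<le> C"
    unfolding C_def by (rule Max_ge; simp)+
  have "f n \<le> C * real n powr a" if "n \<ge> 1" for n
  proof (cases "n < N")
    case True
    have "C * 1 \<le> C * real n powr a"
      using that C(1) by (intro mult_left_mono ge_one_powr_ge_zero) (auto simp: a_def)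
    then show ?thesis
      using C(3)[OF True] by simp
  next
    case False
    then have "f n \<le> c * real n powr (2 - \<epsilon>)"
      using N by simp
    also have "\<dots> \<le> C * real n powr a"
      using that C \<open>c > 0\<close> by (intro mult_mono powr_mono) (auto simp: a_def)
    finally show ?thesis .
  qed
  then show ?thesis
    using that[of C a] C(1) assms(1) by (auto simp: a_def)
qed

theorem corollary13:
  fixes A :: "'a set" and X :: "(int \<Rightarrow> 'a) set"
  assumes "finite A"
    and "subshift A X"
    and "\<exists>\<epsilon>::real. \<epsilon> > 0 \<and> (\<lambda>n. real (complexity X n)) \<in> O(\<lambda>n. real n powr (2 - \<epsilon>))"
  shows "countable (carrier (aut_group A X)) \<and> amenable_group (aut_group A X)"
proof -
  interpret finite_subshift A X
    using assms by unfold_locales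
  obtain C a :: real where Ca: "C \<ge> 1" "1 \<le> a" "a < 2"
    "\<And>n. n \<ge> 1 \<Longrightarrow> complexity X n \<le> C * real n powr a"
    using assms(3) powr_bound_from_bigo by metis
  have "amenable_group (aut_group A X)"
    using group_aut subexponential_growth[OF Ca(4,2,3,1)]
    by (rule amenable_group_if_subexponential_growth)
  with countable_aut show ?thesis ..
qed

end
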